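(* Let $d\ge 2$ be an integer, let $\varepsilon>0$, and put $n=\lceil 1/\varepsilon\rceil$. Suppose it is known in advance that the (otherwise unknown) collection of preference sets $\{A_{ij}\}_{i,j\in\{1,\ldots,d\}}$ on the simplex $A$ has the following property: each $A_{ij}$ is the intersection of $A$ and a closed half-space with boundary hyperplane parallel to the facet $F_j$, and satisfies $F_j\subset A_{ij}$. Then an $\varepsilon$-fair division point can be found in binary mode using at most $$(d-1)^2\left\lceil \log_{\frac{d}{d-1}} n\right\rceil$$ queries. That is, there is an adaptive algorithm in binary mode which, for every collection with this property, makes at most this many queries and outputs an $\varepsilon$-fair division point.
   Context: Let $A$ be a $(d-1)$-dimensional regular simplex with edges of Euclidean length $1$ in $\mathbb{R}^{d-1}$, with vertices $v_1,\ldots,v_d$. Each $x\in A$ is written in barycentric coordinates as $x=[\alpha_1,\ldots,\alpha_d]=\sum_i\alpha_i v_i$ with $\alpha_i\ge 0$, $\sum_i\alpha_i=1$. The facet $F_j$ is the convex hull of $\{v_k\}_{k\ne j}$, so hyperplanes parallel to $F_j$ are those of the form $\{\alpha_j=\text{const}\}$. The metric is $\operatorname{dist}([\alpha_1,\ldots,\alpha_d],[\alpha'_1,\ldots,\alpha'_d])=\max_i|\alpha_i-\alpha'_i|$ (extended to $\mathbb{R}^{d-1}$ by the same formula in affine barycentric coordinates). Preference sets: a collection $\{A_{ij}\}_{i,j\in\{1,\ldots,d\}}$ of closed subsets of $A$ such that for each $i$ (an agent) $\bigcup_{j=1}^d A_{ij}=A$. For $\varepsilon\ge 0$ put $A^{\varepsilon}_{ij}=\{x\in\mathbb{R}^{d-1}:\operatorname{dist}(x,A_{ij})\le\varepsilon\}$.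 A point $x\in A$ is an $\varepsilon$-fair division point if there is a permutation $\sigma$ of $\{1,\ldots,d\}$ with $x\in A^{\varepsilon}_{i\sigma(i)}$ for all $i$. Query model: the sets $A_{ij}$ are fixed but unknown to the algorithm. A query in binary mode consists of choosing indices $i,j\in\{1,\ldots,d\}$ and a point $x\in A$; the answer is "yes" if $x\in A_{ij}$ and "no" otherwise. Each query may depend on the previous answers, and after its queries the algorithm outputs a point of $A$ depending only on $d$, $\varepsilon$ and the answers received. Only the number of queries is counted. *)

theory Defs
  imports "HOL-Analysis.Analysis"
begin

text \<open>The vertices \<open>v 1, \<dots>, v d\<close> live in a Euclidean space \<open>'a\<close> of dimension \<open>d - 1\<close>.
  Agents and pieces are indexed by \<open>{1..d}\<close>; the values of \<open>v\<close> and of a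
  collection \<open>P i j\<close> at other indices are irrelevant.\<close>

definition regular_simplex_vertices :: "nat \<Rightarrow> (nat \<Rightarrow> 'a::euclidean_space) \<Rightarrow> bool" where
  "regular_simplex_vertices d v \<longleftrightarrow>
     DIM('a) = d - 1 \<and> (\<forall>i\<in>{1..d}. \<forall>j\<in>{1..d}. i \<noteq> j \<longrightarrow> dist (v i) (v j) = 1)"

definition cake :: "nat \<Rightarrow> (nat \<Rightarrow> 'a::euclidean_space) \<Rightarrow> 'a set" where
  "cake d v = convex hull (v ` {1..d})"

definition facet :: "nat \<Rightarrow> (nat \<Rightarrow> 'a::euclidean_space) \<Rightarrow> nat \<Rightarrow> 'a set" where
  "facet d v j = convex hull (v ` ({1..d} - {j}))"

text \<open>Affine barycentric coordinates of an arbitrary point of the space. They are uniquely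
  determined on \<open>{1..d}\<close>, and set to \<open>0\<close> elsewhere.\<close>

definition bary :: "nat \<Rightarrow> (nat \<Rightarrow> 'a::euclidean_space) \<Rightarrow> 'a \<Rightarrow> nat \<Rightarrow> real" where
  "bary d v x = (THE \<alpha>. (\<forall>i. i \<notin> {1..d} \<longrightarrow> \<alpha> i = 0) \<and>
                       (\<Sum>i\<in>{1..d}. \<alpha> i) = 1 \<and> (\<Sum>i\<in>{1..d}. \<alpha> i *\<^sub>R v i) = x)"

definition bary_dist :: "nat \<Rightarrow> (nat \<Rightarrow> 'a::euclidean_space) \<Rightarrow> 'a \<Rightarrow> 'a \<Rightarrow> real" where
  "bary_dist d v x y = (MAX i\<in>{1..d}. \<bar>bary d v x i - bary d v y i\<bar>)"

text \<open>The distance from a point to a set is the infimum of the distances to its elements;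
  the distance to the empty set is infinite, so the neighbourhood of \<open>{}\<close> is empty.\<close>

definition bary_nbhd ::
  "nat \<Rightarrow> (nat \<Rightarrow> 'a::euclidean_space) \<Rightarrow> real \<Rightarrow> 'a set \<Rightarrow> 'a set" where
  "bary_nbhd d v \<epsilon> S = {x. S \<noteq> {} \<and> (INF y\<in>S. bary_dist d v x y) \<le> \<epsilon>}"

definition preference_sets ::
  "nat \<Rightarrow> (nat \<Rightarrow> 'a::euclidean_space) \<Rightarrow> (nat \<Rightarrow> nat \<Rightarrow> 'a set) \<Rightarrow> bool" where
  "preference_sets d v P \<longleftrightarrow>
     (\<forall>i\<in>{1..d}. \<forall>j\<in>{1..d}. closed (P i j) \<and> P i j \<subseteq> cake d v) \<and>
     (\<forall>i\<in>{1..d}. (\<Union>j\<in>{1..d}. P i j) = cake d v)"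

definition fair_division_point ::
  "nat \<Rightarrow> (nat \<Rightarrow> 'a::euclidean_space) \<Rightarrow> real \<Rightarrow> (nat \<Rightarrow> nat \<Rightarrow> 'a set) \<Rightarrow> 'a \<Rightarrow> bool" where
  "fair_division_point d v \<epsilon> P x \<longleftrightarrow>
     x \<in> cake d v \<and>
     (\<exists>\<sigma>. \<sigma> permutes {1..d} \<and> (\<forall>i\<in>{1..d}. x \<in> bary_nbhd d v \<epsilon> (P i (\<sigma> i))))"

definition halfspace_parallel_to_facet ::
  "nat \<Rightarrow> (nat \<Rightarrow> 'a::euclidean_space) \<Rightarrow> nat \<Rightarrow> 'a set \<Rightarrow> bool" where
  "halfspace_parallel_to_facet d v j H \<longleftrightarrow>
     (\<exists>a b. a \<noteq> 0 \<and> H = {x. a \<bullet> x \<le> b} \<and>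
            affine_parallel (affine hull (facet d v j)) {x. a \<bullet> x = b})"

definition halfspace_preferences ::
  "nat \<Rightarrow> (nat \<Rightarrow> 'a::euclidean_space) \<Rightarrow> (nat \<Rightarrow> nat \<Rightarrow> 'a set) \<Rightarrow> bool" where
  "halfspace_preferences d v P \<longleftrightarrow>
     (\<forall>i\<in>{1..d}. \<forall>j\<in>{1..d}.
        (\<exists>H. halfspace_parallel_to_facet d v j H \<and> P i j = cake d v \<inter> H) \<and>
        facet d v j \<subseteq> P i j)"

text \<open>An adaptive algorithm in binary mode is a decision tree: \<open>Query i j x yes no\<close> asks
  whether \<open>x \<in> P i j\<close> and continues with \<open>yes\<close> or \<open>no\<close> according to the answer.\<close>

datatype 'p binary_algorithm =
    Output 'p
  | Query nat nat 'p "'p binary_algorithm" "'p binary_algorithm"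

primrec legal_algorithm ::
  "nat \<Rightarrow> (nat \<Rightarrow> 'a::euclidean_space) \<Rightarrow> 'a binary_algorithm \<Rightarrow> bool" where
  "legal_algorithm d v (Output x) \<longleftrightarrow> x \<in> cake d v"
| "legal_algorithm d v (Query i j x yes no) \<longleftrightarrow>
     i \<in> {1..d} \<and> j \<in> {1..d} \<and> x \<in> cake d v \<and>
     legal_algorithm d v yes \<and> legal_algorithm d v no"

primrec run_output :: "(nat \<Rightarrow> nat \<Rightarrow> 'p set) \<Rightarrow> 'p binary_algorithm \<Rightarrow> 'p" where
  "run_output P (Output x) = x"
| "run_output P (Query i j x yes no) =
     (if x \<in> P i j then run_output P yes else run_output P no)"

primrec run_queries :: "(nat \<Rightarrow> nat \<Rightarrow> 'p set) \<Rightarrow> 'p binary_algorithm \<Rightarrow> nat" where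
  "run_queries P (Output x) = 0"
| "run_queries P (Query i j x yes no) =
     Suc (if x \<in> P i j then run_queries P yes else run_queries P no)"

end

theory Submission
  imports Defs
begin

text \<open>Every \<open>A i j\<close> has the form \<open>{\<alpha>. \<alpha> j \<le> t i j}\<close>. The algorithm keeps a
  subsimplex \<open>{\<alpha>. \<forall>k. l k \<le> \<alpha> k}\<close> and a spanning tree on the set of pieces whose edges are the
  agents other than the last one, such that both ends \<open>k\<close> of the edge \<open>i\<close> satisfy
  \<open>l k \<le> t i k\<close>. In each round every agent but the last names a piece acceptable at the
  barycentre, which costs \<open>d - 1\<close> queries per agent. Exchanging edges, one may assume that
  the named piece is an end of the agent's edge. The \<open>d - 1\<close> other ends miss some piece, whose
  lower bound can be raised to the barycentre; this shrinks the simplex by the factor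
  \<open>(d - 1) / d\<close>. Once the size is at most \<open>\<epsilon>\<close>, any point of the subsimplex will do: the last
  agent takes a piece, and orienting the tree away from that piece assigns the others.\<close>

subsection \<open>Connected multigraphs\<close>

text \<open>The edge \<open>i \<in> I\<close> of the multigraph joins \<open>a i\<close> and \<open>b i\<close>; connectedness is
  expressed by the crossing of every cut.\<close>

definition connects :: "'i set \<Rightarrow> 'v set \<Rightarrow> ('i \<Rightarrow> 'v) \<Rightarrow> ('i \<Rightarrow> 'v) \<Rightarrow> bool" where
  "connects I V a b \<longleftrightarrow>
     a ` I \<subseteq> V \<and> b ` I \<subseteq> V \<and>
     (\<forall>S. S \<subseteq> V \<and> S \<noteq> {} \<and> S \<noteq> V \<longrightarrow> (\<exists>i\<in>I. (a i \<in> S) \<noteq> (b i \<in> S)))"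

lemma connects_flip:
  assumes "connects I V a b" "\<forall>i\<in>I. a' i = a i \<and> b' i = b i \<or> a' i = b i \<and> b' i = a i"
  shows "connects I V a' b'"
  unfolding connects_def
proof (intro conjI allI impI)
  have "a i \<in> V" "b i \<in> V" if "i \<in> I" for i
    using assms(1) that by (auto simp: connects_def)
  then show "a' ` I \<subseteq> V" "b' ` I \<subseteq> V" using assms(2) by (metis image_subsetI)+
  fix S assume "S \<subseteq> V \<and> S \<noteq> {} \<and> S \<noteq> V"
  then obtain i where "i \<in> I" "(a i \<in> S) \<noteq> (b i \<in> S)"
    using assms(1) unfolding connects_def by blast
  then show "\<exists>i\<in>I. (a' i \<in> S) \<noteq> (b' i \<in> S)"
    using assms(2) by (intro bexI[of _ i]) auto
qed

text \<open>An uncrossed cut may be replaced by its complement in \<open>V\<close>, so the side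
  avoiding \<open>c\<close> can be chosen.\<close>

lemma not_connectsE:
  assumes "\<not> connects I V a b" "a ` I \<subseteq> V" "b ` I \<subseteq> V"
  obtains S where "S \<subseteq> V" "S \<noteq> {}" "c \<notin> S" "S \<noteq> V" "\<forall>i\<in>I. a i \<in> S \<longleftrightarrow> b i \<in> S"
proof -
  obtain S where S: "S \<subseteq> V" "S \<noteq> {}" "S \<noteq> V" "\<forall>i\<in>I. a i \<in> S \<longleftrightarrow> b i \<in> S"
    using assms unfolding connects_def by blast
  show thesis
  proof (cases "c \<in> S")
    case True
    have "\<forall>i\<in>I. a i \<in> V - S \<longleftrightarrow> b i \<in> V - S" using S(4) assms(2,3) by blast
    moreover have "V - S \<noteq> {}" "V - S \<noteq> V" using S by blast+
    ultimately show thesis using that[of "V - S"] True by blast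
  qed (use that S in blast)
qed

text \<open>If both exchanges failed, there would be uncrossed cuts \<open>S\<close> and
  \<open>T\<close> avoiding \<open>c\<close>. The old edge \<open>i\<close> starts in
  \<open>S\<close> and ends in \<open>T\<close>, so no edge crosses \<open>S \<union> T\<close>,
  which contradicts connectedness.\<close>

lemma connects_exchange:
  assumes conn: "connects I V a b" and i: "i \<in> I" and c: "c \<in> V"
  shows "connects I V (a(i := c)) b \<or> connects I V a (b(i := c))"
proof (rule ccontr)
  assume "\<not> ?thesis"
  then have n1: "\<not> connects I V (a(i := c)) b" and n2: "\<not> connects I V a (b(i := c))" by auto
  have V: "a ` I \<subseteq> V" "b ` I \<subseteq> V" using conn by (auto simp: connects_def)
  obtain S where S: "S \<subseteq> V" "S \<noteq> {}" "c \<notin> S" "\<forall>m\<in>I. (a(i := c)) m \<in> S \<longleftrightarrow> b m \<in> S"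
    by (rule not_connectsE[OF n1, of c]) (use V c in auto)
  obtain T where T: "T \<subseteq> V" "T \<noteq> {}" "c \<notin> T" "\<forall>m\<in>I. a m \<in> T \<longleftrightarrow> (b(i := c)) m \<in> T"
    by (rule not_connectsE[OF n2, of c]) (use V c in auto)
  have cut: "\<exists>m\<in>I. (a m \<in> U) \<noteq> (b m \<in> U)" if "U \<subseteq> V" "U \<noteq> {}" "c \<notin> U" for U
    using conn that c unfolding connects_def by blast
  have "a i \<in> S" "b i \<in> T"
    using cut[OF S(1-3)] S(3,4) cut[OF T(1-3)] T(3,4) i by (auto split: if_splits)
  moreover obtain m where "m \<in> I" "(a m \<in> S \<union> T) \<noteq> (b m \<in> S \<union> T)"
    using cut[of "S \<union> T"] S(1-3) T(1,3) by blast
  ultimately show False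
    using S(4) T(4) by (cases "m = i") auto
qed

text \<open>Edges are exchanged one at a time. Each exchange replaces one old end of
  \<open>j\<close> by \<open>f j\<close> and keeps the other, which becomes
  \<open>b' j\<close>.\<close>

lemma connects_reorient:
  assumes "finite I" and conn: "connects I V a b" and f: "f ` I \<subseteq> V"
  shows "\<exists>b'. connects I V f b' \<and> (\<forall>i\<in>I. b' i \<in> {a i, b i})"
proof -
  have "\<exists>a' b'. connects I V a' b' \<and> (\<forall>i\<in>J. a' i = f i \<and> b' i \<in> {a i, b i}) \<and>
          (\<forall>i\<in>I - J. a' i = a i \<and> b' i = b i)" if "J \<subseteq> I" for J
    using finite_subset[OF that \<open>finite I\<close>] that
  proof (induction J rule: finite_induct)
    case empty
    then show ?case using conn by auto
  next
    case (insert j J)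
    then obtain a' b' where IH: "connects I V a' b'"
        "\<forall>i\<in>J. a' i = f i \<and> b' i \<in> {a i, b i}" "\<forall>i\<in>I - J. a' i = a i \<and> b' i = b i"
      by auto
    have j: "j \<in> I" "j \<notin> J" "f j \<in> V" using insert f by auto
    show ?case
    proof (cases "connects I V (a'(j := f j)) b'")
      case True
      show ?thesis
        by (rule exI[of _ "a'(j := f j)"], rule exI[of _ b'], rule conjI[OF True])
          (use IH(2,3) j in auto)
    next
      case False
      then have "connects I V a' (b'(j := f j))"
        using connects_exchange[OF IH(1) j(1,3)] by blast
      \<comment> \<open>The exchange hit the second end, so the edge is turned round to put
        \<open>f j\<close> first.\<close>
      then have *: "connects I V (a'(j := f j)) (b'(j := a' j))"
        by (rule connects_flip) auto
      show ?thesis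
        by (rule exI[of _ "a'(j := f j)"], rule exI[of _ "b'(j := a' j)"], rule conjI[OF *])
          (use IH(2,3) j in auto)
    qed
  qed
  from this[of I] obtain a' b' where *: "connects I V a' b'"
      "\<forall>i\<in>I. a' i = f i \<and> b' i \<in> {a i, b i}" by auto
  have "connects I V f b'" by (rule connects_flip[OF *(1)]) (use *(2) in simp)
  with * show ?thesis by blast
qed

text \<open>A tree is grown from the root \<open>r\<close>; every new edge is matched with its new vertex.\<close>

lemma connects_root:
  assumes conn: "connects I V a b" and fin: "finite I" "finite V"
    and card: "card V = Suc (card I)" and r: "r \<in> V"
  shows "\<exists>g. bij_betw g I (V - {r}) \<and> (\<forall>i\<in>I. g i \<in> {a i, b i})"
proof -
  have V: "a ` I \<subseteq> V" "b ` I \<subseteq> V" using conn by (auto simp: connects_def)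
  have "\<exists>S J g. r \<in> S \<and> S \<subseteq> V \<and> J \<subseteq> I \<and> card J = m \<and> bij_betw g J (S - {r}) \<and>
          (\<forall>i\<in>J. a i \<in> S \<and> b i \<in> S \<and> g i \<in> {a i, b i})" if "m \<le> card I" for m
    using that
  proof (induction m)
    case 0
    show ?case using r by (intro exI[of _ "{r}"] exI[of _ "{}"] exI[of _ a]) (auto simp: bij_betw_def)
  next
    case (Suc m)
    then obtain S J g where S: "r \<in> S" "S \<subseteq> V" "J \<subseteq> I" "card J = m" "bij_betw g J (S - {r})"
      "\<forall>i\<in>J. a i \<in> S \<and> b i \<in> S \<and> g i \<in> {a i, b i}" by auto
    have "finite S" "finite J" using S fin finite_subset by blast+
    \<comment> \<open>The root makes \<open>S\<close> one larger than \<open>J\<close>, and an edge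
      is still missing, so \<open>S\<close> is a proper cut.\<close>
    have "card S = Suc m"
      using bij_betw_same_card[OF S(5)] S(1,4) \<open>finite S\<close> card_Suc_Diff1 by metis
    then have "S \<noteq> V" using card Suc.prems by auto
    then obtain i where i: "i \<in> I" "(a i \<in> S) \<noteq> (b i \<in> S)"
      using conn S(1,2) unfolding connects_def by blast
    define w where "w = (if a i \<in> S then b i else a i)"
    have w: "w \<notin> S" "w \<in> V" "w \<in> {a i, b i}" using i V by (auto simp: w_def)
    have "i \<notin> J" using i S(6) by auto
    have "bij_betw (g(i := w)) J (S - {r})"
      using S(5) \<open>i \<notin> J\<close> by (subst bij_betw_cong[of J _ g]) auto
    then have "bij_betw (g(i := w)) (insert i J) (insert w (S - {r}))"
      using notIn_Un_bij_betw[OF \<open>i \<notin> J\<close>, of "g(i := w)" "S - {r}"] w(1) by simp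
    moreover have "insert w (S - {r}) = insert w S - {r}" using w(1) S(1) by auto
    ultimately have "bij_betw (g(i := w)) (insert i J) (insert w S - {r})" by simp
    moreover have "card (insert i J) = Suc m" using \<open>i \<notin> J\<close> \<open>finite J\<close> S(4) by simp
    moreover have "\<forall>k\<in>insert i J. a k \<in> insert w S \<and> b k \<in> insert w S \<and> (g(i := w)) k \<in> {a k, b k}"
      using S(6) i(2) by (simp add: w_def)
    moreover have "r \<in> insert w S" "insert w S \<subseteq> V" "insert i J \<subseteq> I" using S(1-3) w(2) i(1) by auto
    ultimately show ?case
      by (intro exI[of _ "insert w S"] exI[of _ "insert i J"] exI[of _ "g(i := w)"] conjI)
  qed
  from this[of "card I"] obtain S J g where S: "r \<in> S" "S \<subseteq> V" "J \<subseteq> I" "card J = card I"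
      "bij_betw g J (S - {r})" "\<forall>i\<in>J. g i \<in> {a i, b i}" by auto
  have J: "J = I" using S fin by (simp add: card_subset_eq)
  have "finite S" using S fin finite_subset by blast
  have "card S = Suc (card I)"
    using bij_betw_same_card[OF S(5)] S(1,4) \<open>finite S\<close> card_Suc_Diff1 by metis
  then have "S = V" using S fin card by (simp add: card_subset_eq)
  with S J show ?thesis by auto
qed

subsection \<open>Barycentric coordinates in a regular simplex\<close>

definition bpoint :: "nat \<Rightarrow> (nat \<Rightarrow> 'a::euclidean_space) \<Rightarrow> (nat \<Rightarrow> real) \<Rightarrow> 'a" where
  "bpoint d v \<alpha> = (\<Sum>i\<in>{1..d}. \<alpha> i *\<^sub>R v i)"

lemma regular_simplex_inj: "regular_simplex_vertices d v \<Longrightarrow> inj_on v {1..d}"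
  by (force simp: regular_simplex_vertices_def inj_on_def)

text \<open>The diagonal accounts for the squares. The 0/1 factor is the squared distance of two
  vertices of the regular simplex.\<close>

lemma sum_product_diff:
  fixes c :: "'i \<Rightarrow> real"
  assumes "finite I"
  shows "(\<Sum>i\<in>I. \<Sum>j\<in>I. c i * c j * (if i = j then 0 else 1)) = (sum c I)\<^sup>2 - (\<Sum>i\<in>I. (c i)\<^sup>2)"
proof -
  have "(\<Sum>i\<in>I. \<Sum>j\<in>I. c i * c j * (if i = j then 0 else 1)) =
      (\<Sum>i\<in>I. \<Sum>j\<in>I. c i * c j - (if i = j then c i * c j else 0))"
    by (intro sum.cong) auto
  also have "\<dots> = (\<Sum>i\<in>I. \<Sum>j\<in>I. c i * c j) - (\<Sum>i\<in>I. (c i)\<^sup>2)"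
    using assms by (simp add: sum_subtractf power2_eq_square)
  finally show ?thesis by (simp add: power2_eq_square sum_product)
qed

text \<open>If \<open>\<Sum> c i = 0\<close>, then \<open>2 * norm (\<Sum> c i *\<^sub>R v i)\<^sup>2 = - (\<Sum> c i * c j * dist (v i) (v j)\<^sup>2) = \<Sum> (c i)\<^sup>2\<close>.\<close>

lemma regular_simplex_affine_independent:
  assumes reg: "regular_simplex_vertices d v"
    and c: "(\<Sum>i\<in>{1..d}. c i) = 0" "(\<Sum>i\<in>{1..d}. c i *\<^sub>R v i) = 0" and i: "i \<in> {1..d}"
  shows "c i = 0"
proof -
  let ?I = "{1..d}"
  have d: "(dist (v i) (v j))\<^sup>2 = (if i = j then 0 else 1)" if "i \<in> ?I" "j \<in> ?I" for i j
    using reg that by (auto simp: regular_simplex_vertices_def)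
  have "c i * c j * (dist (v i) (v j))\<^sup>2 =
      (c i * (v i \<bullet> v i)) * c j + c i * (c j * (v j \<bullet> v j)) - 2 * ((c i *\<^sub>R v i) \<bullet> (c j *\<^sub>R v j))" for i j
    by (simp add: dist_norm power2_norm_eq_inner inner_diff inner_commute algebra_simps)
  then have "(\<Sum>i\<in>?I. \<Sum>j\<in>?I. c i * c j * (dist (v i) (v j))\<^sup>2) =
      (\<Sum>i\<in>?I. \<Sum>j\<in>?I. (c i * (v i \<bullet> v i)) * c j) + (\<Sum>i\<in>?I. \<Sum>j\<in>?I. c i * (c j * (v j \<bullet> v j)))
      - 2 * (\<Sum>i\<in>?I. \<Sum>j\<in>?I. (c i *\<^sub>R v i) \<bullet> (c j *\<^sub>R v j))"
    by (simp only: sum_subtractf sum.distrib sum_distrib_left)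
  \<comment> \<open>Each double sum is a product with \<open>sum c\<close> or the vanishing
    combination of the vertices as a factor.\<close>
  also have "\<dots> = 0"
    by (simp only: sum_product[symmetric] inner_sum_left[symmetric] inner_sum_right[symmetric] c) simp
  finally have "(\<Sum>i\<in>?I. \<Sum>j\<in>?I. c i * c j * (dist (v i) (v j))\<^sup>2) = 0" .
  moreover have "(\<Sum>i\<in>?I. \<Sum>j\<in>?I. c i * c j * (dist (v i) (v j))\<^sup>2) =
      (\<Sum>i\<in>?I. \<Sum>j\<in>?I. c i * c j * (if i = j then 0 else 1))"
    by (intro sum.cong refl) (simp only: d)
  ultimately have "(\<Sum>i\<in>?I. (c i)\<^sup>2) = 0"
    using sum_product_diff[of ?I c] c by simp
  then show ?thesis using i by (simp add: sum_nonneg_eq_0_iff)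
qed

text \<open>Affine independence gives the uniqueness that the definite description in
  \<open>bary\<close> requires.\<close>

lemma bary_bpoint:
  assumes reg: "regular_simplex_vertices d v" and \<alpha>: "(\<Sum>i\<in>{1..d}. \<alpha> i) = 1"
    and i: "i \<in> {1..d}"
  shows "bary d v (bpoint d v \<alpha>) i = \<alpha> i"
proof -
  define \<beta> where "\<beta> = (\<lambda>i. if i \<in> {1..d} then \<alpha> i else 0)"
  have "bary d v (bpoint d v \<alpha>) = \<beta>"
    unfolding bary_def
  proof (rule the_equality)
    show "(\<forall>i. i \<notin> {1..d} \<longrightarrow> \<beta> i = 0) \<and> sum \<beta> {1..d} = 1 \<and>
        (\<Sum>i\<in>{1..d}. \<beta> i *\<^sub>R v i) = bpoint d v \<alpha>"
      using \<alpha> by (auto simp: \<beta>_def bpoint_def intro!: sum.cong)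
  next
    fix \<gamma> assume \<gamma>: "(\<forall>i. i \<notin> {1..d} \<longrightarrow> \<gamma> i = 0) \<and> sum \<gamma> {1..d} = 1 \<and>
        (\<Sum>i\<in>{1..d}. \<gamma> i *\<^sub>R v i) = bpoint d v \<alpha>"
    have "\<gamma> i - \<alpha> i = 0" if "i \<in> {1..d}" for i
      by (rule regular_simplex_affine_independent[OF reg _ _ that])
        (use \<gamma> \<alpha> in \<open>simp_all add: sum_subtractf scaleR_left_diff_distrib bpoint_def\<close>)
    then show "\<gamma> = \<beta>" using \<gamma> by (auto simp: \<beta>_def fun_eq_iff)
  qed
  then show ?thesis using i by (simp add: \<beta>_def)
qed

lemma bpoint_in_cake:
  assumes "\<And>i. i \<in> {1..d} \<Longrightarrow> \<alpha> i \<ge> 0" "(\<Sum>i\<in>{1..d}. \<alpha> i) = 1"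
  shows "bpoint d v \<alpha> \<in> cake d v"
  unfolding bpoint_def cake_def
  by (rule convex_sum) (use assms in \<open>auto intro: hull_inc\<close>)

text \<open>Injectivity of \<open>v\<close> lets weights on points be read as weights on
  indices.\<close>

lemma cakeE:
  assumes reg: "regular_simplex_vertices d v" and x: "x \<in> cake d v"
  obtains \<alpha> where "\<And>i. i \<in> {1..d} \<Longrightarrow> \<alpha> i \<ge> 0" "(\<Sum>i\<in>{1..d}. \<alpha> i) = 1" "x = bpoint d v \<alpha>"
proof -
  have inj: "inj_on v {1..d}" using reg by (rule regular_simplex_inj)
  obtain u where u: "\<forall>y\<in>v ` {1..d}. 0 \<le> u y" "sum u (v ` {1..d}) = 1"
      "(\<Sum>y\<in>v ` {1..d}. u y *\<^sub>R y) = x"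
    using x unfolding cake_def by (auto simp: convex_hull_finite)
  show thesis
    by (rule that[of "u \<circ> v"])
      (use u sum.reindex[OF inj, of u] sum.reindex[OF inj, of "\<lambda>y. u y *\<^sub>R y"]
        in \<open>auto simp: bpoint_def\<close>)
qed

section \<open>Half-space preferences as coordinate thresholds\<close>

text \<open>The analysis of the algorithm uses the half-spaces only through \<open>t\<close>.
  Nonnegativity expresses that the facet \<open>j\<close>, where coordinate \<open>j\<close> is
  zero, lies in \<open>P i j\<close>.\<close>

definition thresholds ::
  "nat \<Rightarrow> (nat \<Rightarrow> 'a::euclidean_space) \<Rightarrow> (nat \<Rightarrow> nat \<Rightarrow> 'a set) \<Rightarrow> (nat \<Rightarrow> nat \<Rightarrow> real) \<Rightarrow> bool" where
  "thresholds d v P t \<longleftrightarrow>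
     (\<forall>i\<in>{1..d}. \<forall>j\<in>{1..d}. t i j \<ge> 0 \<and> P i j = {x \<in> cake d v. bary d v x j \<le> t i j})"

text \<open>On the affine hull of the vertices, the linear functional that defines the half-space equals
  \<open>m + \<alpha> j * (w - m)\<close>, where \<open>m\<close> is its value on the facet and \<open>w\<close> its value at the
  opposite vertex.\<close>

lemma halfspace_threshold:
  assumes d: "d \<ge> 2" and reg: "regular_simplex_vertices d v" and j: "j \<in> {1..d}"
    and H: "halfspace_parallel_to_facet d v j H" and sub: "facet d v j \<subseteq> H"
  shows "\<exists>t\<ge>0. cake d v \<inter> H = {x \<in> cake d v. bary d v x j \<le> t}"
proof -
  obtain a b where H_eq: "H = {x. a \<bullet> x \<le> b}"
    and par: "affine_parallel (affine hull (facet d v j)) {x. a \<bullet> x = b}"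
    using H by (auto simp: halfspace_parallel_to_facet_def)
  obtain c where c: "{x. a \<bullet> x = b} = (\<lambda>x. c + x) ` (affine hull (facet d v j))"
    using par by (auto simp: affine_parallel_def)
  define m where "m = b - a \<bullet> c"
  define w where "w = a \<bullet> v j"
  have vF: "v k \<in> facet d v j" if "k \<in> {1..d} - {j}" for k
    using that by (auto simp: facet_def intro: hull_inc)
  have vm: "a \<bullet> v k = m" if "k \<in> {1..d} - {j}" for k
  proof -
    have "c + v k \<in> {x. a \<bullet> x = b}" unfolding c using vF[OF that] by (auto intro: hull_inc)
    then show ?thesis by (simp add: m_def inner_add_right)
  qed
  \<comment> \<open>A second vertex exists as \<open>d \<ge> 2\<close>; it makes the facet nonempty
    and yields \<open>m \<le> b\<close>.\<close>
  obtain k where k: "k \<in> {1..d} - {j}"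
  proof -
    have "(if j = 1 then 2 else 1) \<in> {1..d} - {j}" using d by auto
    then show thesis using that by blast
  qed
  have mb: "m \<le> b" using vF[OF k] vm[OF k] sub H_eq by auto
  have val: "a \<bullet> x = m + bary d v x j * (w - m)" and bnds: "bary d v x j \<le> 1" "0 \<le> bary d v x j"
    if "x \<in> cake d v" for x
  proof -
    obtain \<alpha> where \<alpha>: "\<And>i. i \<in> {1..d} \<Longrightarrow> \<alpha> i \<ge> 0" "(\<Sum>i\<in>{1..d}. \<alpha> i) = 1" "x = bpoint d v \<alpha>"
      using cakeE[OF reg \<open>x \<in> cake d v\<close>] by blast
    have bj: "bary d v x j = \<alpha> j" using bary_bpoint[OF reg \<alpha>(2) j] \<alpha>(3) by simp
    have split: "(\<Sum>i\<in>{1..d}. \<alpha> i) = \<alpha> j + (\<Sum>i\<in>{1..d} - {j}. \<alpha> i)"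
      using j by (simp add: sum.remove)
    have nn: "(\<Sum>i\<in>{1..d} - {j}. \<alpha> i) \<ge> 0" by (rule sum_nonneg) (use \<alpha>(1) in auto)
    have "a \<bullet> x = (\<Sum>i\<in>{1..d}. \<alpha> i * (a \<bullet> v i))"
      by (simp add: \<alpha>(3) bpoint_def inner_sum_right)
    also have "\<dots> = \<alpha> j * w + (\<Sum>i\<in>{1..d} - {j}. \<alpha> i * (a \<bullet> v i))"
      using j by (simp add: sum.remove w_def)
    also have "(\<Sum>i\<in>{1..d} - {j}. \<alpha> i * (a \<bullet> v i)) = (\<Sum>i\<in>{1..d} - {j}. \<alpha> i) * m"
      unfolding sum_distrib_right by (intro sum.cong refl) (simp only: vm)
    also have "(\<Sum>i\<in>{1..d} - {j}. \<alpha> i) = 1 - \<alpha> j" using split \<alpha>(2) by simp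
    finally show "a \<bullet> x = m + bary d v x j * (w - m)" unfolding bj by (simp add: algebra_simps)
    show "bary d v x j \<le> 1" "0 \<le> bary d v x j" using bj split \<alpha>(1,2) nn j by auto
  qed
  show ?thesis
  proof (cases "w \<le> m")
    \<comment> \<open>The functional never exceeds \<open>m\<close> on the cake, so the whole cake
      lies in \<open>H\<close>, and 1 bounds every coordinate.\<close>
    case True
    have "a \<bullet> x \<le> b" if "x \<in> cake d v" for x
      using val[OF that] mb mult_nonneg_nonpos[of "bary d v x j" "w - m"] bnds[OF that] True
      by linarith
    then show ?thesis using bnds by (intro exI[of _ 1]) (auto simp: H_eq)
  next
    case False
    then have "a \<bullet> x \<le> b \<longleftrightarrow> bary d v x j \<le> (b - m) / (w - m)" if "x \<in> cake d v" for x
      unfolding val[OF that] by (auto simp: pos_le_divide_eq)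
    then show ?thesis using False mb
      by (intro exI[of _ "(b - m) / (w - m)"]) (auto simp: H_eq)
  qed
qed

lemma halfspace_preferences_thresholds:
  assumes "d \<ge> 2" "regular_simplex_vertices d v" "halfspace_preferences d v P"
  shows "\<exists>t. thresholds d v P t"
proof -
  have "\<exists>s\<ge>0. P i j = {x \<in> cake d v. bary d v x j \<le> s}" if "i \<in> {1..d}" "j \<in> {1..d}" for i j
  proof -
    obtain H where "halfspace_parallel_to_facet d v j H" "P i j = cake d v \<inter> H"
        "facet d v j \<subseteq> P i j"
      using assms(3) \<open>i \<in> {1..d}\<close> \<open>j \<in> {1..d}\<close> unfolding halfspace_preferences_def by blast
    then show ?thesis using halfspace_threshold[OF assms(1,2) \<open>j \<in> {1..d}\<close>] by auto
  qed
  then show ?thesis unfolding thresholds_def by metis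
qed

text \<open>The excess of coordinate \<open>k\<close> over \<open>t\<close> is moved to another
  coordinate. This reaches the set within distance \<epsilon>, and \<open>t \<ge> 0\<close> keeps
  the lowered coordinate nonnegative.\<close>

lemma bary_nbhd_threshold:
  assumes d: "d \<ge> 2" and reg: "regular_simplex_vertices d v" and \<epsilon>: "\<epsilon> \<ge> 0"
    and \<alpha>: "\<And>i. i \<in> {1..d} \<Longrightarrow> \<alpha> i \<ge> 0" "(\<Sum>i\<in>{1..d}. \<alpha> i) = 1"
    and k: "k \<in> {1..d}" and t: "t \<ge> 0" "\<alpha> k \<le> t + \<epsilon>"
  shows "bpoint d v \<alpha> \<in> bary_nbhd d v \<epsilon> {x \<in> cake d v. bary d v x k \<le> t}"
proof -
  let ?x = "bpoint d v \<alpha>" and ?S = "{x \<in> cake d v. bary d v x k \<le> t}"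
  define \<delta> where "\<delta> = max 0 (\<alpha> k - t)"
  obtain m where m: "m \<in> {1..d}" "m \<noteq> k"
  proof -
    have "(if k = 1 then 2 else 1) \<in> {1..d}" "(if k = 1 then 2 else 1) \<noteq> k" using d by auto
    then show thesis using that by blast
  qed
  define \<beta> where "\<beta> = \<alpha>(k := \<alpha> k - \<delta>, m := \<alpha> m + \<delta>)"
  have "\<beta> i = \<alpha> i + (if i = m then \<delta> else 0) - (if i = k then \<delta> else 0)" for i
    using m by (auto simp: \<beta>_def)
  then have \<beta>1: "(\<Sum>i\<in>{1..d}. \<beta> i) = 1"
    using m k \<alpha>(2) by (simp add: sum.distrib sum_subtractf)
  have \<beta>0: "\<beta> i \<ge> 0" if "i \<in> {1..d}" for i
    using \<alpha>(1)[OF that] \<alpha>(1)[OF k] t by (auto simp: \<beta>_def \<delta>_def max_def)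
  have \<beta>k: "\<beta> k \<le> t" using m by (simp add: \<beta>_def \<delta>_def)
  have y: "bpoint d v \<beta> \<in> ?S"
    using bpoint_in_cake[OF \<beta>0 \<beta>1, of v] bary_bpoint[OF reg \<beta>1 k] \<beta>k by simp
  have "\<bar>bary d v ?x i - bary d v (bpoint d v \<beta>) i\<bar> \<le> \<epsilon>" if "i \<in> {1..d}" for i
  proof -
    have "\<bar>\<alpha> i - \<beta> i\<bar> \<le> \<epsilon>" using t \<epsilon> by (auto simp: \<beta>_def \<delta>_def)
    then show ?thesis by (simp only: bary_bpoint[OF reg \<alpha>(2) that] bary_bpoint[OF reg \<beta>1 that])
  qed
  then have dist: "bary_dist d v ?x (bpoint d v \<beta>) \<le> \<epsilon>"
    unfolding bary_dist_def using d by (subst Max_le_iff) auto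
  have nonneg: "bary_dist d v ?x y \<ge> 0" for y
    unfolding bary_dist_def using d
    by (intro order.trans[OF _ Max_ge[of _ "\<bar>bary d v ?x 1 - bary d v y 1\<bar>"]]) auto
  have "(INF y\<in>?S. bary_dist d v ?x y) \<le> \<epsilon>"
    by (rule cINF_lower2[where f = "bary_dist d v ?x", OF _ y dist]) (rule bdd_belowI2[of _ 0], rule nonneg)
  then show ?thesis using y unfolding bary_nbhd_def by blast
qed

subsection \<open>The algorithm\<close>

text \<open>Since the pieces of an agent cover the cake, the label \<open>1\<close> needs no query.\<close>

primrec ask_agent ::
  "nat \<Rightarrow> 'p \<Rightarrow> (nat \<Rightarrow> 'p binary_algorithm) \<Rightarrow> nat \<Rightarrow> 'p binary_algorithm" where
  "ask_agent i x C 0 = C 1"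
| "ask_agent i x C (Suc m) = Query i (Suc (Suc m)) x (C (Suc (Suc m))) (ask_agent i x C m)"

text \<open>Answers are collected in \<open>f\<close> and handed to the continuation
  \<open>C\<close>, since a decision tree has no other memory. Agents are asked in decreasing order,
  \<open>m\<close> first.\<close>

primrec ask_agents ::
  "nat \<Rightarrow> 'p \<Rightarrow> ((nat \<Rightarrow> nat) \<Rightarrow> 'p binary_algorithm) \<Rightarrow> nat \<Rightarrow> (nat \<Rightarrow> nat) \<Rightarrow> 'p binary_algorithm" where
  "ask_agents d x C 0 f = C f"
| "ask_agents d x C (Suc m) f = ask_agent (Suc m) x (\<lambda>j. ask_agents d x C m (f(Suc m := j))) (d - 1)"

section \<open>Legality, outcome and cost of a round of queries\<close>

lemma legal_ask_agent:
  assumes "m < d" "i \<in> {1..d}" "x \<in> cake d v" "\<And>j. j \<in> {1..d} \<Longrightarrow> legal_algorithm d v (C j)"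
  shows "legal_algorithm d v (ask_agent i x C m)"
  using assms by (induction m) auto

lemma legal_ask_agents:
  assumes "m \<le> d" "x \<in> cake d v" "\<And>f. \<forall>i. f i \<in> {1..d} \<Longrightarrow> legal_algorithm d v (C f)"
    and "\<forall>i. f i \<in> {1..d}"
  shows "legal_algorithm d v (ask_agents d x C m f)"
  using assms(1,4)
proof (induction m arbitrary: f)
  case 0
  then show ?case using assms(3) by simp
next
  case (Suc m)
  then show ?case using assms(2) by (auto intro!: legal_ask_agent)
qed

text \<open>Each \<open>no\<close> passes the hypothesis on to the smaller labels, until at label 1
  it is the conclusion.\<close>

lemma run_ask_agent:
  assumes "\<exists>j\<in>{1..Suc m}. x \<in> P i j"
  shows "\<exists>j\<in>{1..Suc m}. x \<in> P i j \<and> run_output P (ask_agent i x C m) = run_output P (C j) \<and>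
           run_queries P (ask_agent i x C m) \<le> m + run_queries P (C j)"
  using assms
proof (induction m)
  case 0
  then show ?case by auto
next
  case (Suc m)
  show ?case
  proof (cases "x \<in> P i (Suc (Suc m))")
    case True
    then show ?thesis by (intro bexI[of _ "Suc (Suc m)"]) auto
  next
    case False
    then have "\<exists>j\<in>{1..Suc m}. x \<in> P i j" using Suc.prems by (auto simp: le_Suc_eq)
    from Suc.IH[OF this] show ?thesis using False by fastforce
  qed
qed

text \<open>That \<open>g\<close> agrees with \<open>f\<close> outside \<open>{1..m}\<close> serves
  the induction: the answer of agent \<open>Suc m\<close> survives the remaining questions.\<close>

lemma run_ask_agents:
  assumes d: "d \<ge> 1" and "m \<le> d" "\<forall>i\<in>{1..d}. \<exists>j\<in>{1..d}. x \<in> P i j" "\<forall>i. f i \<in> {1..d}"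
  shows "\<exists>g. (\<forall>i. g i \<in> {1..d}) \<and> (\<forall>i. i \<notin> {1..m} \<longrightarrow> g i = f i) \<and> (\<forall>i\<in>{1..m}. x \<in> P i (g i)) \<and>
           run_output P (ask_agents d x C m f) = run_output P (C g) \<and>
           run_queries P (ask_agents d x C m f) \<le> m * (d - 1) + run_queries P (C g)"
  using assms(2,4)
proof (induction m arbitrary: f)
  case 0
  then show ?case by auto
next
  case (Suc m)
  let ?C = "\<lambda>j. ask_agents d x C m (f(Suc m := j))"
  have "\<exists>j\<in>{1..Suc (d - 1)}. x \<in> P (Suc m) j" using assms(3) Suc.prems d by simp
  from run_ask_agent[where P = P and C = ?C, OF this] d obtain j where j: "j \<in> {1..d}" "x \<in> P (Suc m) j"
      "run_output P (ask_agents d x C (Suc m) f) = run_output P (?C j)"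
      "run_queries P (ask_agents d x C (Suc m) f) \<le> d - 1 + run_queries P (?C j)" by auto
  have "\<forall>i. (f(Suc m := j)) i \<in> {1..d}" using j Suc.prems by auto
  from Suc.IH[OF Suc_leD[OF Suc.prems(1)] this] obtain g where g: "\<forall>i. g i \<in> {1..d}"
      "\<forall>i. i \<notin> {1..m} \<longrightarrow> g i = (f(Suc m := j)) i" "\<forall>i\<in>{1..m}. x \<in> P i (g i)"
      "run_output P (?C j) = run_output P (C g)"
      "run_queries P (?C j) \<le> m * (d - 1) + run_queries P (C g)" by blast
  have "g (Suc m) = j" using g(2) by simp
  then have "\<forall>i\<in>{1..Suc m}. x \<in> P i (g i)" using g(3) j(2) by (auto simp: le_Suc_eq)
  moreover have "\<forall>i. i \<notin> {1..Suc m} \<longrightarrow> g i = f i" using g(2) by auto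
  moreover have "run_queries P (ask_agents d x C (Suc m) f) \<le> Suc m * (d - 1) + run_queries P (C g)"
    using g(5) j(4) by simp
  ultimately show ?case using g(1,4) j(3) by (intro exI[of _ g] conjI) simp_all
qed

text \<open>The barycentre of the subsimplex \<open>{\<alpha>. \<forall>k. l k \<le> \<alpha> k}\<close>, whose edges are scaled by
  \<open>1 - (\<Sum>k. l k)\<close>.\<close>

definition center :: "nat \<Rightarrow> (nat \<Rightarrow> real) \<Rightarrow> nat \<Rightarrow> real" where
  "center d l k = l k + (1 - (\<Sum>k\<in>{1..d}. l k)) / real d"

lemma sum_center: "d \<ge> 1 \<Longrightarrow> (\<Sum>k\<in>{1..d}. center d l k) = 1"
  by (simp add: center_def sum.distrib)

lemma center_ge: "(\<Sum>k\<in>{1..d}. l k) \<le> 1 \<Longrightarrow> l k \<le> center d l k"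
  by (simp add: center_def)

text \<open>Here \<open>l k\<close> is the largest amount of piece \<open>k\<close> that is currently known to be acceptable for
  every agent whose edge ends in \<open>k\<close>.\<close>

definition known_acceptable ::
  "nat \<Rightarrow> (nat \<Rightarrow> nat \<Rightarrow> real) \<Rightarrow> (nat \<Rightarrow> real) \<Rightarrow> (nat \<Rightarrow> nat) \<Rightarrow> (nat \<Rightarrow> nat) \<Rightarrow> bool" where
  "known_acceptable d t l a b \<longleftrightarrow>
     connects {1..<d} {1..d} a b \<and> (\<forall>i\<in>{1..<d}. l (a i) \<le> t i (a i) \<and> l (b i) \<le> t i (b i))"

text \<open>In one round every agent \<open>i < d\<close> names a piece \<open>f i\<close> acceptable at the centre, and its edge is
  exchanged for one from \<open>f i\<close> to an old end \<open>b' i\<close>. The \<open>d - 1\<close> old ends miss some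
  piece \<open>k\<close>, so \<open>l k\<close> may be raised to the \<open>k\<close>-th coordinate of the centre.\<close>

lemma raise_bound:
  assumes d: "d \<ge> 2" and conn: "connects {1..<d} {1..d} a b" and f: "\<forall>i. f i \<in> {1..d}"
    and l: "(\<Sum>k\<in>{1..d}. l k) \<le> 1"
  shows "\<exists>k b'. k \<in> {1..d} \<and> connects {1..<d} {1..d} f b' \<and>
           (\<forall>t. known_acceptable d t l a b \<and> (\<forall>i\<in>{1..<d}. center d l (f i) \<le> t i (f i)) \<longrightarrow>
                known_acceptable d t (l(k := center d l k)) f b')"
proof -
  obtain b' where b': "connects {1..<d} {1..d} f b'" "\<forall>i\<in>{1..<d}. b' i \<in> {a i, b i}"
    using connects_reorient[OF finite_atLeastLessThan conn, of f] f by blast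
  have "card (b' ` {1..<d}) < card {1..d}"
    using card_image_le[of "{1..<d}" b'] d by (auto intro: le_less_trans)
  then have "\<not> {1..d} \<subseteq> b' ` {1..<d}" by (meson card_mono finite_atLeastLessThan finite_imageI not_le)
  then obtain k where k: "k \<in> {1..d}" "k \<notin> b' ` {1..<d}" by blast
  have "known_acceptable d t (l(k := center d l k)) f b'"
    if "known_acceptable d t l a b" "\<forall>i\<in>{1..<d}. center d l (f i) \<le> t i (f i)" for t
    unfolding known_acceptable_def
  proof (intro conjI ballI)
    fix i assume i: "i \<in> {1..<d}"
    \<comment> \<open>At \<open>f i\<close> the agent accepts the centre itself, which covers even a
      raised bound; the old ends avoid \<open>k\<close>, so their bounds are unchanged.\<close>
    show "(l(k := center d l k)) (f i) \<le> t i (f i)"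
      using that(2) i center_ge[OF l, of "f i"] by (auto intro: order.trans)
    have "b' i \<noteq> k" using k i by auto
    moreover have "l (b' i) \<le> t i (b' i)"
      using b'(2) that(1) i unfolding known_acceptable_def by fastforce
    ultimately show "(l(k := center d l k)) (b' i) \<le> t i (b' i)" by simp
  qed (use b' in simp)
  with k b' show ?thesis by blast
qed

section \<open>Narrowing the subsimplex round by round\<close>

text \<open>The tree is fixed before \<open>P\<close> and \<open>t\<close>, whereas the final bounds
  and edges depend on the answers and are only asserted to exist.\<close>

definition narrows_down ::
  "nat \<Rightarrow> (nat \<Rightarrow> 'a::euclidean_space) \<Rightarrow> nat \<Rightarrow> (nat \<Rightarrow> real) \<Rightarrow> (nat \<Rightarrow> nat) \<Rightarrow> (nat \<Rightarrow> nat) \<Rightarrow>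
     'a binary_algorithm \<Rightarrow> bool" where
  "narrows_down d v L l a b T \<longleftrightarrow> legal_algorithm d v T \<and>
    (\<forall>P t. preference_sets d v P \<and> thresholds d v P t \<and> known_acceptable d t l a b \<longrightarrow>
       run_queries P T \<le> (d - 1)\<^sup>2 * L \<and>
       (\<exists>l' a' b'. known_acceptable d t l' a' b' \<and> (\<forall>k\<in>{1..d}. l' k \<ge> 0) \<and>
          1 - (\<Sum>k\<in>{1..d}. l' k) = (1 - (\<Sum>k\<in>{1..d}. l k)) * ((real d - 1) / real d) ^ L \<and>
          (\<Sum>k\<in>{1..d}. l' k) \<le> 1 \<and> run_output P T = bpoint d v (center d l')))"

text \<open>Induction on \<open>L\<close>: one round is asked at the centre, and each vector of
  answers continues with the tree that the induction hypothesis gives for its new bounds and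
  edges.\<close>

lemma search_algorithm:
  assumes d: "d \<ge> 2" and reg: "regular_simplex_vertices d v"
    and conn: "connects {1..<d} {1..d} a b"
    and l: "\<And>k. k \<in> {1..d} \<Longrightarrow> l k \<ge> 0" "(\<Sum>k\<in>{1..d}. l k) \<le> 1"
  shows "\<exists>T. narrows_down d v L l a b T"
  using conn l
proof (induction L arbitrary: l a b)
  case 0
  have "bpoint d v (center d l) \<in> cake d v"
    by (rule bpoint_in_cake) (use 0 center_ge[of l d] sum_center[of d l] d in \<open>auto intro: order.trans\<close>)
  then have "narrows_down d v 0 l a b (Output (bpoint d v (center d l)))"
    unfolding narrows_down_def using 0 by (fastforce simp del: One_nat_def)
  then show ?case by blast
next
  case (Suc L)
  let ?c = "center d l" and ?x = "bpoint d v (center d l)"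
  define s where "s = 1 - (\<Sum>k\<in>{1..d}. l k)"
  have s: "s \<ge> 0" using Suc.prems s_def by simp
  have sum1: "(\<Sum>k\<in>{1..d}. ?c k) = 1" using sum_center d by simp
  have c_ge: "l k \<le> ?c k" for k using center_ge Suc.prems by blast
  have x: "?x \<in> cake d v"
    by (rule bpoint_in_cake[OF _ sum1]) (use Suc.prems(2) c_ge in \<open>auto intro: order.trans\<close>)
  \<comment> \<open>The choice of \<open>k\<close> and \<open>b'\<close> precedes the unknown
    \<open>t\<close>, so the continuation depends on the answers \<open>f\<close> alone.\<close>
  have "\<forall>f. \<exists>k b'. (\<forall>i. f i \<in> {1..d}) \<longrightarrow>
     k \<in> {1..d} \<and> connects {1..<d} {1..d} f b' \<and>
     (\<forall>t. known_acceptable d t l a b \<and> (\<forall>i\<in>{1..<d}. ?c (f i) \<le> t i (f i)) \<longrightarrow>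
        known_acceptable d t (l(k := ?c k)) f b')"
    using raise_bound[OF d Suc.prems(1) _ Suc.prems(3)] by blast
  then obtain k b' where kb: "\<And>f. \<forall>i. f i \<in> {1..d} \<Longrightarrow> k f \<in> {1..d}"
    "\<And>f. \<forall>i. f i \<in> {1..d} \<Longrightarrow> connects {1..<d} {1..d} f (b' f)"
    "\<And>f t. \<forall>i. f i \<in> {1..d} \<Longrightarrow> known_acceptable d t l a b \<Longrightarrow>
      \<forall>i\<in>{1..<d}. ?c (f i) \<le> t i (f i) \<Longrightarrow> known_acceptable d t (l(k f := ?c (k f))) f (b' f)"
    by metis
  define l' where "l' = (\<lambda>f. l(k f := ?c (k f)))"
  have l'0: "l' f m \<ge> 0" if "m \<in> {1..d}" for f m
    using Suc.prems(2)[OF that] c_ge[of m] by (auto simp: l'_def)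
  \<comment> \<open>Raising one bound to the centre adds \<open>s / d\<close> to the sum of the
    bounds.\<close>
  have l's: "1 - (\<Sum>m\<in>{1..d}. l' f m) = s * ((real d - 1) / real d)" if "\<forall>i. f i \<in> {1..d}" for f
  proof -
    have "l' f m = l m + (if m = k f then s / real d else 0)" for m
      by (simp add: l'_def center_def s_def)
    then have "(\<Sum>m\<in>{1..d}. l' f m) = (1 - s) + s / real d"
      using kb(1)[OF that] by (simp add: sum.distrib s_def)
    then show ?thesis using d by (simp add: field_simps)
  qed
  have l'1: "(\<Sum>m\<in>{1..d}. l' f m) \<le> 1" if "\<forall>i. f i \<in> {1..d}" for f
  proof -
    have "s * ((real d - 1) / real d) \<ge> 0" using s d by simp
    then show ?thesis using l's[OF that] by linarith
  qed
  have "\<exists>T. narrows_down d v L (l' f) f (b' f) T" if "\<forall>i. f i \<in> {1..d}" for f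
    using Suc.IH[OF kb(2)[OF that] l'0 l'1[OF that]] by blast
  then obtain C where C: "\<And>f. \<forall>i. f i \<in> {1..d} \<Longrightarrow> narrows_down d v L (l' f) f (b' f) (C f)" by metis
  \<comment> \<open>The start value 1 is a placeholder that keeps all labels legal; agents 1 to
    \<open>d - 1\<close> overwrite it, at \<open>d - 1\<close> queries each at most.\<close>
  let ?T = "ask_agents d ?x C (d - 1) (\<lambda>_. 1)"
  have one: "\<forall>i. (\<lambda>_::nat. 1::nat) i \<in> {1..d}" using d by auto
  have "legal_algorithm d v ?T"
    by (rule legal_ask_agents[OF _ x _ one]) (use C in \<open>auto simp: narrows_down_def\<close>)
  moreover have "run_queries P ?T \<le> (d - 1)\<^sup>2 * Suc L \<and>
       (\<exists>l'' a' b''. known_acceptable d t l'' a' b'' \<and> (\<forall>k\<in>{1..d}. l'' k \<ge> 0) \<and>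
          1 - (\<Sum>k\<in>{1..d}. l'' k) = (1 - (\<Sum>k\<in>{1..d}. l k)) * ((real d - 1) / real d) ^ Suc L \<and>
          (\<Sum>k\<in>{1..d}. l'' k) \<le> 1 \<and> run_output P ?T = bpoint d v (center d l''))"
    if P: "preference_sets d v P" "thresholds d v P t" "known_acceptable d t l a b" for P t
  proof -
    have covers: "\<forall>i\<in>{1..d}. \<exists>j\<in>{1..d}. ?x \<in> P i j" using P(1) x unfolding preference_sets_def by blast
    have "1 \<le> d" "d - 1 \<le> d" using d by auto
    from run_ask_agents[where C = C and f = "\<lambda>_. 1", OF this covers one] obtain g where
      g: "\<forall>i. g i \<in> {1..d}" "\<forall>i\<in>{1..d - 1}. ?x \<in> P i (g i)"
      "run_output P ?T = run_output P (C g)"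
      "run_queries P ?T \<le> (d - 1) * (d - 1) + run_queries P (C g)" by blast
    have "?c (g i) \<le> t i (g i)" if "i \<in> {1..<d}" for i
    proof -
      have "?x \<in> P i (g i)" "i \<in> {1..d}" using g(2) that by auto
      then show ?thesis
        using P(2) g(1) bary_bpoint[OF reg sum1, of "g i"] unfolding thresholds_def by fastforce
    qed
    then have "known_acceptable d t (l' g) g (b' g)"
      unfolding l'_def using kb(3)[OF g(1) P(3)] by blast
    then have *: "run_queries P (C g) \<le> (d - 1)\<^sup>2 * L"
       "\<exists>l'' a' b''. known_acceptable d t l'' a' b'' \<and> (\<forall>k\<in>{1..d}. l'' k \<ge> 0) \<and>
          1 - (\<Sum>k\<in>{1..d}. l'' k) = s * ((real d - 1) / real d) * ((real d - 1) / real d) ^ L \<and>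
          (\<Sum>k\<in>{1..d}. l'' k) \<le> 1 \<and> run_output P (C g) = bpoint d v (center d l'')"
      using C[OF g(1)] P(1,2) unfolding narrows_down_def l's[OF g(1)] by blast+
    have "run_queries P ?T \<le> (d - 1)\<^sup>2 * Suc L"
      using g(4) *(1) by (simp add: power2_eq_square)
    moreover have "s * ((real d - 1) / real d) * ((real d - 1) / real d) ^ L =
        s * ((real d - 1) / real d) ^ Suc L" by simp
    ultimately show ?thesis using *(2) g(3) unfolding s_def by metis
  qed
  ultimately have "narrows_down d v (Suc L) l a b ?T" unfolding narrows_down_def by blast
  then show ?case by blast
qed

text \<open>Agent \<open>d\<close>, who is never queried, chooses first.\<close>

lemma fair_division_point_center:
  assumes d: "d \<ge> 2" and reg: "regular_simplex_vertices d v"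
    and P: "preference_sets d v P" "thresholds d v P t"
    and acc: "known_acceptable d t l a b" and l: "\<And>k. k \<in> {1..d} \<Longrightarrow> l k \<ge> 0" "(\<Sum>k\<in>{1..d}. l k) \<le> 1"
    and small: "1 - (\<Sum>k\<in>{1..d}. l k) \<le> \<epsilon>"
  shows "fair_division_point d v \<epsilon> P (bpoint d v (center d l))"
proof -
  let ?c = "center d l" and ?x = "bpoint d v (center d l)"
  have sum1: "(\<Sum>k\<in>{1..d}. ?c k) = 1" using sum_center d by simp
  have c_ge: "l k \<le> ?c k" for k using center_ge l by blast
  have c0: "?c k \<ge> 0" if "k \<in> {1..d}" for k using l(1)[OF that] c_ge[of k] by linarith
  \<comment> \<open>The centre exceeds each bound by only the \<open>d\<close>-th part of the
    size.\<close>
  have c_le: "?c k \<le> l k + \<epsilon>" for k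
  proof -
    have "(1 - (\<Sum>k\<in>{1..d}. l k)) / real d \<le> (1 - (\<Sum>k\<in>{1..d}. l k)) / 1"
      using d l(2) by (intro divide_left_mono) auto
    then show ?thesis using small by (simp add: center_def)
  qed
  have \<epsilon>: "\<epsilon> \<ge> 0" using small l(2) by linarith
  have x: "?x \<in> cake d v" by (rule bpoint_in_cake[OF c0 sum1])
  have "d \<in> {1..d}" using d by simp
  then have "(\<Union>j\<in>{1..d}. P d j) = cake d v" using P(1) unfolding preference_sets_def by blast
  then obtain r where r: "r \<in> {1..d}" "?x \<in> P d r" using x by blast
  have conn: "connects {1..<d} {1..d} a b" using acc by (simp add: known_acceptable_def)
  have "card {1..d} = Suc (card {1..<d})" using d by simp
  then obtain g where g: "bij_betw g {1..<d} ({1..d} - {r})" "\<forall>i\<in>{1..<d}. g i \<in> {a i, b i}"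
    using connects_root[OF conn _ _ _ r(1)] by blast
  \<comment> \<open>Agent \<open>d\<close> takes the root \<open>r\<close>, the other agents take
    the vertices matched to their edges, and indices outside \<open>{1..d}\<close> stay fixed as
    \<open>permutes\<close> demands.\<close>
  define \<sigma> where "\<sigma> i = (if i \<in> {1..<d} then g i else if i = d then r else i)" for i
  have "bij_betw \<sigma> {1..<d} ({1..d} - {r})"
    using g(1) by (subst bij_betw_cong[of _ _ g]) (auto simp: \<sigma>_def)
  moreover have "bij_betw \<sigma> {d} {r}" by (auto simp: \<sigma>_def)
  ultimately have "bij_betw \<sigma> ({1..<d} \<union> {d}) (({1..d} - {r}) \<union> {r})"
    by (rule bij_betw_combine) auto
  moreover have "{1..<d} \<union> {d} = {1..d}" "({1..d} - {r}) \<union> {r} = {1..d}" using r d by auto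
  ultimately have "bij_betw \<sigma> {1..d} {1..d}" by simp
  then have perm: "\<sigma> permutes {1..d}"
    by (rule bij_imp_permutes) (use d in \<open>auto simp: \<sigma>_def\<close>)
  have "?x \<in> bary_nbhd d v \<epsilon> (P i (\<sigma> i))" if i: "i \<in> {1..d}" for i
  proof -
    have \<sigma>i: "\<sigma> i \<in> {1..d}" using permutes_in_image[OF perm] i by blast
    then have t: "t i (\<sigma> i) \<ge> 0" "P i (\<sigma> i) = {x \<in> cake d v. bary d v x (\<sigma> i) \<le> t i (\<sigma> i)}"
      using P(2) i by (auto simp: thresholds_def)
    have "?c (\<sigma> i) \<le> t i (\<sigma> i) + \<epsilon>"
    proof (cases "i = d")
      case True
      then have "\<sigma> i = r" by (simp add: \<sigma>_def)
      then show ?thesis using r t(2) True bary_bpoint[OF reg sum1 r(1)] \<epsilon> by auto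
    next
      case False
      then have id: "i \<in> {1..<d}" using i by auto
      then have "\<sigma> i \<in> {a i, b i}" using g(2) by (simp add: \<sigma>_def)
      then have "l (\<sigma> i) \<le> t i (\<sigma> i)" using acc id unfolding known_acceptable_def by auto
      then show ?thesis using c_le[of "\<sigma> i"] by linarith
    qed
    then show ?thesis using bary_nbhd_threshold[OF d reg \<epsilon> c0 sum1 \<sigma>i t(1)] t(2) by simp
  qed
  then show ?thesis using x perm unfolding fair_division_point_def by blast
qed

section \<open>The number of rounds and the initial star\<close>

theorem corollary4p6:
  fixes d :: nat and v :: "nat \<Rightarrow> 'a::euclidean_space" and \<epsilon> :: real and n :: int
  assumes "d \<ge> 2" and "regular_simplex_vertices d v"
    and "\<epsilon> > 0" and "n = \<lceil>1 / \<epsilon>\<rceil>"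
  shows "\<exists>T. legal_algorithm d v T \<and>
           (\<forall>P. preference_sets d v P \<and> halfspace_preferences d v P \<longrightarrow>
              int (run_queries P T) \<le>
                (int d - 1)\<^sup>2 * \<lceil>log (real d / (real d - 1)) (real_of_int n)\<rceil> \<and>
              fair_division_point d v \<epsilon> P (run_output P T))"
proof -
  define q where "q = real d / (real d - 1)"
  define L where "L = nat \<lceil>log q (real_of_int n)\<rceil>"
  have q: "q > 1" using assms(1) by (simp add: q_def)
  have n1: "n \<ge> 1" using assms(3,4) by (simp add: less_ceiling_iff int_one_le_iff_zero_less)
  \<comment> \<open>The logarithm is nonnegative, so \<open>nat\<close> in \<open>L\<close> loses
    nothing.\<close>
  have "log q (real_of_int n) \<ge> 0" using q n1 by simp
  then have L: "int L = \<lceil>log q (real_of_int n)\<rceil>" by (simp add: L_def)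
  \<comment> \<open>Starting from size 1, \<open>L\<close> rounds leave size
    \<open>1 / q ^ L\<close>, at most \<open>1 / n\<close> and hence at most \<epsilon>.\<close>
  then have "log q (real_of_int n) \<le> real L" by linarith
  then have "real_of_int n \<le> q powr real L" using q n1 by (simp add: log_le_iff)
  also have "\<dots> = q ^ L" using q by (simp add: powr_realpow)
  finally have "1 / \<epsilon> \<le> q ^ L" using assms(4) le_of_int_ceiling[of "1 / \<epsilon>"] by linarith
  then have "inverse (q ^ L) \<le> \<epsilon>" using assms(3) q by (simp add: field_simps)
  moreover have "inverse (q ^ L) = ((real d - 1) / real d) ^ L" by (simp add: q_def flip: power_inverse)
  ultimately have small: "((real d - 1) / real d) ^ L \<le> \<epsilon>" by simp

  \<comment> \<open>The initial tree is a star: edge \<open>i\<close> joins the pieces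
    \<open>i\<close> and \<open>d\<close>. Zero bounds are acceptable because thresholds are
    nonnegative.\<close>
  let ?a = "\<lambda>i::nat. i" and ?b = "\<lambda>i::nat. d" and ?l = "\<lambda>k::nat. 0::real"
  have conn: "connects {1..<d} {1..d} ?a ?b"
    unfolding connects_def
  proof (intro conjI allI impI)
    fix S assume S: "S \<subseteq> {1..d} \<and> S \<noteq> {} \<and> S \<noteq> {1..d}"
    then obtain i j where "i \<in> S" "j \<in> {1..d} - S" by blast
    \<comment> \<open>The edge of any leaf separated from \<open>d\<close> crosses the cut.\<close>
    then show "\<exists>i\<in>{1..<d}. (i \<in> S) \<noteq> (d \<in> S)"
      using S by (cases "d \<in> S") (force intro: bexI[of _ j] bexI[of _ i] simp: less_le)+
  qed (use assms(1) in auto)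
  obtain T where T: "narrows_down d v L ?l ?a ?b T"
    using search_algorithm[OF assms(1,2) conn, of ?l L] by auto
  have "int (run_queries P T) \<le> (int d - 1)\<^sup>2 * \<lceil>log q (real_of_int n)\<rceil> \<and>
      fair_division_point d v \<epsilon> P (run_output P T)"
    if P: "preference_sets d v P" "halfspace_preferences d v P" for P
  proof -
    obtain t where t: "thresholds d v P t"
      using halfspace_preferences_thresholds[OF assms(1,2) P(2)] by blast
    then have "known_acceptable d t ?l ?a ?b"
      using conn assms(1) by (auto simp: known_acceptable_def thresholds_def)
    with T P(1) t have run: "run_queries P T \<le> (d - 1)\<^sup>2 * L"
      "\<exists>l a b. known_acceptable d t l a b \<and> (\<forall>k\<in>{1..d}. l k \<ge> 0) \<and>
          1 - (\<Sum>k\<in>{1..d}. l k) = ((real d - 1) / real d) ^ L \<and>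
          (\<Sum>k\<in>{1..d}. l k) \<le> 1 \<and> run_output P T = bpoint d v (center d l)"
      unfolding narrows_down_def by auto
    from run(1) have "int (run_queries P T) \<le> int ((d - 1)\<^sup>2 * L)" by (rule of_nat_mono)
    also have "\<dots> = (int d - 1)\<^sup>2 * \<lceil>log q (real_of_int n)\<rceil>"
      using assms(1) by (simp add: L of_nat_diff)
    finally show ?thesis
      using run(2) fair_division_point_center[OF assms(1,2) P(1) t] small by metis
  qed
  with T show ?thesis unfolding q_def narrows_down_def by blast
qed

end
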